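(* Let $0\le k\le n$ with $n\ge 1$, and let $L$ be a $k$-rUCG with $n$ control qubits, $m$ target qubits and target operator family $\mathcal U$. Then $L$ can be decomposed as a product of $\sum_{i=1}^{k}\binom{n}{i}$ gates of type CU, a single gate of type U, and fewer than $2\sum_{i=0}^{k}\binom{n}{i}$ CNOT gates.
   Context: $\mathcal U$ is a subgroup of the unitary group on the $m$ target qubits that is Abelian and 2-divisible (for every $U\in\mathcal U$ there is $V\in\mathcal U$ with $V^2=U$). The control qubits are labeled by $[n]=\{1,\dots,n\}$. For $Q\subseteq[n]$ and a unitary $V$ on the target register, $C_Q[V]$ is the gate applying $V$ to the target register if all control qubits in $Q$ are in state $|1\rangle$ and the identity otherwise (positive controls; $C_\emptyset[V]=I\otimes V$). A (standard) $k$-rUCG is an operator that can be written as a finite product $\prod_i C_{Q_i}[U_i]$ with $U_i\in\mathcal U$ and $|Q_i|\le k$ for all $i$. Gate types (the gates act on the $n$ control and $m$ target qubits): a gate of type U applies some $V\in\mathcal U$ to the target register unconditionally; a gate of type CU applies some $V\in\mathcal U$ to the target register conditioned on a single qubit being in state $|1\rangle$. Elements of $\mathcal U$ (including the identity) and their singly-controlled versions are treated as indivisible unit gates. *)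

theory Defs
  imports Complex_Main "HOL-Algebra.Group" "Jordan_Normal_Form.Schur_Decomposition"
begin

definition unitary_mat :: "nat \<Rightarrow> complex mat \<Rightarrow> bool" where
  "unitary_mat d V \<longleftrightarrow>
     V \<in> carrier_mat d d \<and> mat_adjoint V * V = 1\<^sub>m d \<and> V * mat_adjoint V = 1\<^sub>m d"

definition unitary_group :: "nat \<Rightarrow> complex mat monoid" where
  "unitary_group d = \<lparr>carrier = {V. unitary_mat d V}, monoid.mult = (*), one = 1\<^sub>m d\<rparr>"

definition two_divisible :: "complex mat set \<Rightarrow> bool" where
  "two_divisible \<U> \<longleftrightarrow> (\<forall>U\<in>\<U>. \<exists>V\<in>\<U>. V * V = U)"

text \<open>
  Operators on \<open>N\<close> qubits are \<open>2 ^ N \<times> 2 ^ N\<close> matrices over the computational basis. Qubits are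
  numbered \<open>1, \<dots>, N\<close> and qubit \<open>1\<close> is the most significant bit of a basis index, so that the
  index order agrees with the Kronecker product. With \<open>n\<close> control qubits \<open>1, \<dots>, n\<close> and \<open>m\<close> target
  qubits \<open>n + 1, \<dots>, n + m\<close>, the basis state \<open>i\<close> has control part \<open>i div 2 ^ m\<close> and target part
  \<open>i mod 2 ^ m\<close>.
\<close>

definition qubit_one :: "nat \<Rightarrow> nat \<Rightarrow> nat \<Rightarrow> bool" where
  "qubit_one N i q \<longleftrightarrow> bit i (N - q)"

definition ctrl_gate :: "nat \<Rightarrow> nat \<Rightarrow> nat set \<Rightarrow> complex mat \<Rightarrow> complex mat" where
  "ctrl_gate n m Q V = mat (2 ^ (n + m)) (2 ^ (n + m)) (\<lambda>(i, j).
     if i div 2 ^ m \<noteq> j div 2 ^ m then 0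
     else if \<forall>q\<in>Q. qubit_one (n + m) j q then V $$ (i mod 2 ^ m, j mod 2 ^ m)
     else 1\<^sub>m (2 ^ m) $$ (i mod 2 ^ m, j mod 2 ^ m))"

definition cnot_gate :: "nat \<Rightarrow> nat \<Rightarrow> nat \<Rightarrow> complex mat" where
  "cnot_gate N c t = mat (2 ^ N) (2 ^ N) (\<lambda>(i, j).
     if i = (if qubit_one N j c then flip_bit (N - t) j else j) then 1 else 0)"

definition mat_prod :: "nat \<Rightarrow> complex mat list \<Rightarrow> complex mat" where
  "mat_prod d As = foldr (*) As (1\<^sub>m d)"

definition is_rUCG :: "nat \<Rightarrow> nat \<Rightarrow> complex mat set \<Rightarrow> nat \<Rightarrow> complex mat \<Rightarrow> bool" where
  "is_rUCG n m \<U> k L \<longleftrightarrow>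
     (\<exists>ps. (\<forall>(Q, U)\<in>set ps. Q \<subseteq> {1..n} \<and> card Q \<le> k \<and> U \<in> \<U>) \<and>
           L = mat_prod (2 ^ (n + m)) (map (\<lambda>(Q, U). ctrl_gate n m Q U) ps))"

datatype gate =
    is_U_gate: U_gate "complex mat"
  | is_CU_gate: CU_gate nat "complex mat"
  | is_CNOT_gate: CNOT_gate nat nat

text \<open>
  A CNOT may act on any two distinct qubits among the \<open>n + m\<close> control and target qubits; the
  condition of a CU gate is one of the control qubits.
\<close>

fun valid_gate :: "nat \<Rightarrow> nat \<Rightarrow> complex mat set \<Rightarrow> gate \<Rightarrow> bool" where
  "valid_gate n m \<U> (U_gate V) \<longleftrightarrow> V \<in> \<U>"
| "valid_gate n m \<U> (CU_gate q V) \<longleftrightarrow> q \<in> {1..n} \<and> V \<in> \<U>"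
| "valid_gate n m \<U> (CNOT_gate c t) \<longleftrightarrow> c \<in> {1..n + m} \<and> t \<in> {1..n + m} \<and> c \<noteq> t"

fun gate_mat :: "nat \<Rightarrow> nat \<Rightarrow> gate \<Rightarrow> complex mat" where
  "gate_mat n m (U_gate V) = ctrl_gate n m {} V"
| "gate_mat n m (CU_gate q V) = ctrl_gate n m {q} V"
| "gate_mat n m (CNOT_gate c t) = cnot_gate (n + m) c t"

lemma dim_mat_adjoint [simp]:
  "dim_row (mat_adjoint A) = dim_col A" "dim_col (mat_adjoint A) = dim_row A"
  by (simp_all add: mat_adjoint_def)

lemma index_mat_adjoint [simp]:
  "i < dim_col A \<Longrightarrow> j < dim_row A \<Longrightarrow> mat_adjoint A $$ (i, j) = conjugate (A $$ (j, i))"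
  by (simp add: mat_adjoint_def mat_of_rows_def)

lemma mat_adjoint_carrier [simp]:
  "A \<in> carrier_mat r c \<Longrightarrow> mat_adjoint A \<in> carrier_mat c r"
  by (auto intro!: carrier_matI)

lemma mat_adjoint_mult:
  fixes A B :: "complex mat"
  assumes "A \<in> carrier_mat r s" "B \<in> carrier_mat s c"
  shows "mat_adjoint (A * B) = mat_adjoint B * mat_adjoint A"
  using assms by (intro eq_matI) (auto simp: scalar_prod_def mult.commute)

lemma mat_adjoint_adjoint [simp]: "mat_adjoint (mat_adjoint (A :: complex mat)) = A"
  by (intro eq_matI) auto

lemma mat_adjoint_one [simp]: "mat_adjoint (1\<^sub>m d :: complex mat) = 1\<^sub>m d"
  by (intro eq_matI) auto

lemma unitary_mat_one: "unitary_mat d (1\<^sub>m d)"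
  by (simp add: unitary_mat_def)

lemma unitary_mat_adjoint: "unitary_mat d V \<Longrightarrow> unitary_mat d (mat_adjoint V)"
  by (simp add: unitary_mat_def)

lemma unitary_mat_mult:
  assumes "unitary_mat d V" "unitary_mat d W"
  shows "unitary_mat d (V * W)"
proof -
  have c: "V \<in> carrier_mat d d" "W \<in> carrier_mat d d"
    using assms by (auto simp: unitary_mat_def)
  have c': "mat_adjoint V \<in> carrier_mat d d" "mat_adjoint W \<in> carrier_mat d d"
    using c by auto
  have sq: "(A * B) * (C * D) = A * ((B * C) * D)"
    if "A \<in> carrier_mat d d" "B \<in> carrier_mat d d" "C \<in> carrier_mat d d" "D \<in> carrier_mat d d"
    for A B C D :: "complex mat"
    using that assoc_mult_mat[of A d d B d "C * D" d] assoc_mult_mat[of B d d C d D d] by simp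
  have 1: "(mat_adjoint W * mat_adjoint V) * (V * W) = mat_adjoint W * ((mat_adjoint V * V) * W)"
    by (rule sq) (use c c' in auto)
  have 2: "(V * W) * (mat_adjoint W * mat_adjoint V) = V * ((W * mat_adjoint W) * mat_adjoint V)"
    by (rule sq) (use c c' in auto)
  show ?thesis
    using assms c c' 1 2 by (simp add: unitary_mat_def mat_adjoint_mult[of V d d W d])
qed

lemma group_unitary_group: "group (unitary_group d)"
proof (rule groupI)
  fix x assume "x \<in> carrier (unitary_group d)"
  then show "\<exists>y\<in>carrier (unitary_group d). y \<otimes>\<^bsub>unitary_group d\<^esub> x = \<one>\<^bsub>unitary_group d\<^esub>"
    by (intro bexI[of _ "mat_adjoint x"])
      (auto simp: unitary_group_def intro: unitary_mat_adjoint simp: unitary_mat_def)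
next
  fix x y z
  assume "x \<in> carrier (unitary_group d)" "y \<in> carrier (unitary_group d)" "z \<in> carrier (unitary_group d)"
  then show "x \<otimes>\<^bsub>unitary_group d\<^esub> y \<otimes>\<^bsub>unitary_group d\<^esub> z =
      x \<otimes>\<^bsub>unitary_group d\<^esub> (y \<otimes>\<^bsub>unitary_group d\<^esub> z)"
    by (simp add: unitary_group_def unitary_mat_def assoc_mult_mat[of x d d y d z d])
next
  fix x assume "x \<in> carrier (unitary_group d)"
  then show "\<one>\<^bsub>unitary_group d\<^esub> \<otimes>\<^bsub>unitary_group d\<^esub> x = x"
    by (auto simp: unitary_group_def unitary_mat_def)
qed (simp_all add: unitary_group_def unitary_mat_one unitary_mat_mult)

end

theory Submission
  imports Defs
begin

text \<open>
  A $k$-rUCG is block diagonal, with the value of a function of degree at most $k$ of the control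
  bits in each block. For a bit $y$ we have $y = \frac12 - \frac12 (-1)^y$, so square roots in
  the target family turn a factor conditioned on one control into an unconditional factor and a
  factor whose exponent is the sign $(-1)^y$. Signs multiply as parities do, hence a signed factor
  $s^{(-1)^{x_q}}$ is split once more along the last control $j$ on which $s$ depends into a signed
  factor for $x_q$ and one for $x_q \oplus x_j$; the latter is the former conjugated by a CNOT
  from $j$ to $q$. A constant signed factor costs one CU gate, up to a constant that is
  collected in the single U gate. Splitting follows Pascal's rule, which gives the number of CU
  gates, and every split costs two CNOTs and creates one more CU gate.
\<close>

section \<open>Block diagonal operators over the control register\<close>

text \<open>Blocks depend on the control bits rather than on a basis index, so that conditions on
  controls become conditions on the argument. Only labels in \<open>{1..n}\<close> are meaningful:
  by truncated subtraction a label above \<open>n\<close> reads bit 0.\<close>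

definition block_diag :: "nat \<Rightarrow> nat \<Rightarrow> ((nat \<Rightarrow> bool) \<Rightarrow> complex mat) \<Rightarrow> complex mat" where
  "block_diag n m F = mat (2 ^ (n + m)) (2 ^ (n + m)) (\<lambda>(i, j).
     if i div 2 ^ m \<noteq> j div 2 ^ m then 0
     else F (qubit_one n (j div 2 ^ m)) $$ (i mod 2 ^ m, j mod 2 ^ m))"

lemma block_diag_dim [simp]:
  "dim_row (block_diag n m F) = 2 ^ (n + m)" "dim_col (block_diag n m F) = 2 ^ (n + m)"
  by (simp_all add: block_diag_def)

text \<open>Qubit 1 is the most significant bit, so a control keeps its label when the target bits
  are cut off; \<open>q \<le> n\<close> gives \<open>n + m - q = m + (n - q)\<close>.\<close>

lemma qubit_one_div:
  assumes "q \<le> n"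
  shows "qubit_one (n + m) i q \<longleftrightarrow> qubit_one n (i div 2 ^ m) q"
  using assms by (simp add: qubit_one_def bit_iff_odd div_mult2_eq [symmetric] power_add [symmetric] add.commute)

lemma ctrl_gate_eq_block_diag:
  assumes "Q \<subseteq> {1..n}"
  shows "ctrl_gate n m Q V = block_diag n m (\<lambda>x. if \<forall>q\<in>Q. x q then V else 1\<^sub>m (2 ^ m))"
proof -
  have "(\<forall>q\<in>Q. qubit_one (n + m) j q) \<longleftrightarrow> (\<forall>q\<in>Q. qubit_one n (j div 2 ^ m) q)" for j
    using assms by (intro ball_cong) (auto intro!: qubit_one_div)
  then show ?thesis
    by (intro eq_matI) (auto simp: ctrl_gate_def block_diag_def)
qed

lemma block_diag_one: "block_diag n m (\<lambda>x. 1\<^sub>m (2 ^ m)) = 1\<^sub>m (2 ^ (n + m))"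
proof (intro eq_matI)
  fix i j :: nat
  assume "i < dim_row (1\<^sub>m (2 ^ (n + m)) :: complex mat)" "j < dim_col (1\<^sub>m (2 ^ (n + m)) :: complex mat)"
  moreover have "i = j" if "i div 2 ^ m = j div 2 ^ m" "i mod 2 ^ m = j mod 2 ^ m"
    using that by (metis div_mult_mod_eq)
  ultimately show "block_diag n m (\<lambda>x. 1\<^sub>m (2 ^ m)) $$ (i, j) = 1\<^sub>m (2 ^ (n + m)) $$ (i, j)"
    by (auto simp: block_diag_def)
qed simp_all

lemma sum_div_block:
  fixes f :: "nat \<Rightarrow> 'a :: comm_monoid_add"
  assumes "a < 2 ^ n"
  shows "(\<Sum>l<2 ^ (n + m). if l div 2 ^ m = a then f l else 0) = (\<Sum>r<2 ^ m. f (a * 2 ^ m + r))"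
proof -
  have lt: "l < 2 ^ (n + m)" if "l div 2 ^ m = a" for l :: nat
    using that assms by (auto simp: power_add div_less_iff_less_mult)
  have "(\<Sum>l<2 ^ (n + m). if l div 2 ^ m = a then f l else 0) = (\<Sum>l | l div 2 ^ m = a. f l)"
    using lt by (intro sum.mono_neutral_cong_right) auto
  also have "\<dots> = (\<Sum>r<2 ^ m. f (a * 2 ^ m + r))"
    by (rule sum.reindex_bij_witness [where i = "\<lambda>r. a * 2 ^ m + r" and j = "\<lambda>l. l mod 2 ^ m"])
      (auto, (metis div_mult_mod_eq)+)
  finally show ?thesis .
qed

lemma block_diag_mult:
  assumes "\<And>x. F x \<in> carrier_mat (2 ^ m) (2 ^ m)" "\<And>x. H x \<in> carrier_mat (2 ^ m) (2 ^ m)"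
  shows "block_diag n m F * block_diag n m H = block_diag n m (\<lambda>x. F x * H x)"
proof (intro eq_matI)
  fix i j
  assume "i < dim_row (block_diag n m (\<lambda>x. F x * H x))" "j < dim_col (block_diag n m (\<lambda>x. F x * H x))"
  then have ij: "i < 2 ^ (n + m)" "j < 2 ^ (n + m)" by simp_all
  define a b where "a = i div 2 ^ m" and "b = j div 2 ^ m"
  have b: "b < 2 ^ n"
    using ij by (simp add: b_def power_add div_less_iff_less_mult)
  let ?x = "qubit_one n b"
  have "(block_diag n m F * block_diag n m H) $$ (i, j) =
        (\<Sum>l<2 ^ (n + m). block_diag n m F $$ (i, l) * block_diag n m H $$ (l, j))"
    using ij by (simp add: scalar_prod_def atLeast0LessThan)
  \<comment> \<open>The right factor forces \<open>l\<close> into the block of \<open>j\<close>, the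
    left one into that of \<open>i\<close>, so nothing remains unless \<open>a = b\<close>.\<close>
  also have "\<dots> = (\<Sum>l<2 ^ (n + m). if l div 2 ^ m = b then
      (if a = b then F ?x $$ (i mod 2 ^ m, l mod 2 ^ m) * H ?x $$ (l mod 2 ^ m, j mod 2 ^ m) else 0) else 0)"
    using ij by (intro sum.cong) (auto simp: block_diag_def a_def b_def)
  also have "\<dots> = (\<Sum>r<2 ^ m. if a = b then F ?x $$ (i mod 2 ^ m, r) * H ?x $$ (r, j mod 2 ^ m) else 0)"
    unfolding sum_div_block [OF b] by (intro sum.cong) auto
  also have "\<dots> = block_diag n m (\<lambda>x. F x * H x) $$ (i, j)"
    using ij assms [of ?x]
    by (auto simp: block_diag_def a_def b_def scalar_prod_def atLeast0LessThan carrier_matD)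
  finally show "(block_diag n m F * block_diag n m H) $$ (i, j) = block_diag n m (\<lambda>x. F x * H x) $$ (i, j)" .
qed simp_all

section \<open>Conjugation by CNOT gates\<close>

definition cnot_perm :: "nat \<Rightarrow> nat \<Rightarrow> nat \<Rightarrow> nat \<Rightarrow> nat" where
  "cnot_perm N c t j = (if qubit_one N j c then flip_bit (N - t) j else j)"

lemma cnot_perm_invol:
  assumes "c \<le> N" "t \<le> N" "c \<noteq> t"
  shows "cnot_perm N c t (cnot_perm N c t j) = j"
proof -
  have "N - c \<noteq> N - t" using assms by auto
  then show ?thesis
    by (auto simp: cnot_perm_def qubit_one_def bit_eq_iff bit_flip_bit_iff)
qed

lemma qubit_one_cnot_perm:
  assumes "q \<le> N" "t \<le> N"
  shows "qubit_one N (cnot_perm N c t j) q \<longleftrightarrow>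
         (if q = t then qubit_one N j t \<noteq> qubit_one N j c else qubit_one N j q)"
  using assms by (auto simp: cnot_perm_def qubit_one_def bit_flip_bit_iff)

lemma cnot_perm_less:
  assumes "1 \<le> t" "t \<le> N" "j < 2 ^ N"
  shows "cnot_perm N c t j < 2 ^ N"
proof -
  have "take_bit N (flip_bit (N - t) j) = flip_bit (N - t) j"
    using assms take_bit_nat_eq_self [of j N]
    by (intro bit_eqI) (auto simp: bit_take_bit_iff bit_flip_bit_iff, metis bit_take_bit_iff)
  then show ?thesis
    using assms by (auto simp: cnot_perm_def take_bit_nat_eq_self_iff)
qed

lemma cnot_perm_mod:
  assumes "t \<le> n"
  shows "cnot_perm (n + m) c t j mod 2 ^ m = j mod 2 ^ m"
  using assms unfolding take_bit_eq_mod [symmetric]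
  by (intro bit_eqI) (auto simp: cnot_perm_def bit_take_bit_iff bit_flip_bit_iff)

lemma cnot_perm_div:
  assumes "c \<le> n" "t \<le> n"
  shows "cnot_perm (n + m) c t j div 2 ^ m = cnot_perm n c t (j div 2 ^ m)"
proof -
  have "flip_bit (n + m - t) j div 2 ^ m = flip_bit (n - t) (j div 2 ^ m)"
    using assms unfolding drop_bit_eq_div [symmetric]
    by (intro bit_eqI) (auto simp: bit_drop_bit_eq bit_flip_bit_iff)
  then show ?thesis
    using assms by (simp add: cnot_perm_def qubit_one_div)
qed

lemma cnot_gate_carrier [simp]: "cnot_gate N c t \<in> carrier_mat (2 ^ N) (2 ^ N)"
  by (simp add: cnot_gate_def)

text \<open>A CNOT is the matrix of an involutive permutation of basis states. Multiplying by it
  permutes columns on the right and rows on the left, both by this involution.\<close>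

lemma cnot_gate_conj:
  assumes A: "A \<in> carrier_mat (2 ^ N) (2 ^ N)"
    and ct: "1 \<le> t" "c \<le> N" "t \<le> N" "c \<noteq> t"
  shows "cnot_gate N c t * (A * cnot_gate N c t) =
         mat (2 ^ N) (2 ^ N) (\<lambda>(i, j). A $$ (cnot_perm N c t i, cnot_perm N c t j))"
proof -
  let ?\<sigma> = "cnot_perm N c t"
  have inv: "i = ?\<sigma> l \<longleftrightarrow> l = ?\<sigma> i" for i l
    using cnot_perm_invol [OF ct(2-4)] by metis
  have right: "(A * cnot_gate N c t) $$ (i, j) = A $$ (i, ?\<sigma> j)" if "i < 2 ^ N" "j < 2 ^ N" for i j
    using that A cnot_perm_less [OF ct(1,3), of j c]
    by (simp add: scalar_prod_def cnot_gate_def cnot_perm_def [symmetric] if_distrib sum.delta cong: if_cong)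
  have left: "(cnot_gate N c t * B) $$ (i, j) = B $$ (?\<sigma> i, j)"
    if "i < 2 ^ N" "j < 2 ^ N" "B \<in> carrier_mat (2 ^ N) (2 ^ N)" for i j B
    using that cnot_perm_less [OF ct(1,3), of i c]
    by (simp add: scalar_prod_def cnot_gate_def cnot_perm_def [symmetric] inv [of i] if_distrib
        if_distribR sum.delta cong: if_cong)
  show ?thesis
    using A cnot_perm_less [OF ct(1,3), of _ c]
    by (intro eq_matI) (auto simp: left right intro!: carrier_matD [OF cnot_gate_carrier])
qed

definition cnot_bits :: "nat \<Rightarrow> nat \<Rightarrow> (nat \<Rightarrow> bool) \<Rightarrow> nat \<Rightarrow> bool" where
  "cnot_bits c t x = x(t := (x t \<noteq> x c))"

text \<open>Permuting basis states and updating the assignment at \<open>t\<close> agree in general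
  only on the labels in \<open>{1..n}\<close>, since labels above \<open>n\<close> alias qubit
  \<open>n\<close>; hence the condition on \<open>F\<close>.\<close>

lemma cnot_gate_conj_block_diag:
  assumes ct: "1 \<le> t" "c \<le> n" "t \<le> n" "c \<noteq> t"
    and F: "\<And>x y. (\<forall>q\<in>{1..n}. x q = y q) \<Longrightarrow> F x = F y"
  shows "cnot_gate (n + m) c t * (block_diag n m F * cnot_gate (n + m) c t) =
         block_diag n m (\<lambda>x. F (cnot_bits c t x))"
proof -
  have "F (qubit_one n (cnot_perm n c t a)) = F (cnot_bits c t (qubit_one n a))" for a
    using ct by (intro F) (auto simp: qubit_one_cnot_perm cnot_bits_def)
  moreover have "cnot_perm n c t a = cnot_perm n c t b \<longleftrightarrow> a = b" for a b
    using cnot_perm_invol [OF ct(2-4)] by metis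
  moreover have "cnot_perm (n + m) c t i < 2 ^ (n + m)" if "i < 2 ^ (n + m)" for i
    using ct that by (intro cnot_perm_less) auto
  ultimately show ?thesis
    using ct by (subst cnot_gate_conj)
      (auto simp: block_diag_def cnot_perm_div cnot_perm_mod intro!: eq_matI)
qed

section \<open>Functions of bounded degree in the control bits\<close>

context comm_group
begin

text \<open>
  Here \<open>deg_funs j r\<close> consists of the functions of the bits \<open>1, \<dots>, j\<close> of degree at most \<open>r\<close>,
  written multiplicatively.
\<close>

primrec deg_funs :: "nat \<Rightarrow> nat \<Rightarrow> ((nat \<Rightarrow> bool) \<Rightarrow> 'a) set" where
  "deg_funs 0 r = {\<lambda>x. c | c. c \<in> carrier G}"
| "deg_funs (Suc j) r = (case r of 0 \<Rightarrow> {\<lambda>x. c | c. c \<in> carrier G}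
     | Suc r' \<Rightarrow> {\<lambda>x. g x \<otimes> (if x (Suc j) then h x else \<one>) | g h.
                   g \<in> deg_funs j r \<and> h \<in> deg_funs j r'})"

text \<open>Follows both recursive calls at once; the two base cases, no bits left and no degree
  left, are merged into constants.\<close>

lemma deg_funs_induct [consumes 1, case_names const step]:
  assumes "f \<in> deg_funs j r"
    and "\<And>j r c. j = 0 \<or> r = 0 \<Longrightarrow> c \<in> carrier G \<Longrightarrow> P j r (\<lambda>x. c)"
    and "\<And>j r g h. g \<in> deg_funs j (Suc r) \<Longrightarrow> P j (Suc r) g \<Longrightarrow> h \<in> deg_funs j r \<Longrightarrow> P j r h \<Longrightarrow>
           P (Suc j) (Suc r) (\<lambda>x. g x \<otimes> (if x (Suc j) then h x else \<one>))"
  shows "P j r f"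
  using assms(1)
proof (induction j arbitrary: r f)
  case 0
  then show ?case using assms(2) by auto
next
  case (Suc j)
  then show ?case
    by (cases r) (auto intro: assms(2) intro!: assms(3))
qed

lemma deg_funs_const: "c \<in> carrier G \<Longrightarrow> (\<lambda>x. c) \<in> deg_funs j r"
proof (induction j arbitrary: r c)
  case (Suc j)
  have "(\<lambda>x. c \<otimes> (if x (Suc j) then \<one> else \<one>)) \<in> deg_funs (Suc j) (Suc r')" for r'
    using Suc.IH [of c "Suc r'"] Suc.IH [of \<one> r'] Suc.prems
    unfolding deg_funs.simps nat.case by (intro CollectI exI [of _ "\<lambda>x. c"] exI [of _ "\<lambda>x. \<one>"]) auto
  then show ?case using Suc by (cases r) auto
qed auto

lemma deg_funs_closed: "f \<in> deg_funs j r \<Longrightarrow> f x \<in> carrier G"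
  by (induction rule: deg_funs_induct) auto

lemma deg_funs_cong:
  "f \<in> deg_funs j r \<Longrightarrow> \<forall>q\<in>{1..j}. x q = y q \<Longrightarrow> f x = f y"
proof (induction rule: deg_funs_induct)
  case (step j r g h)
  then have "g x = g y" "h x = h y" "x (Suc j) = y (Suc j)" by auto
  then show ?case by simp
qed simp

lemma deg_funs_step:
  assumes "g \<in> deg_funs j (Suc r)" "h \<in> deg_funs j r"
  shows "(\<lambda>x. g x \<otimes> (if x (Suc j) then h x else \<one>)) \<in> deg_funs (Suc j) (Suc r)"
  using assms by auto

lemma deg_funs_mult:
  "f \<in> deg_funs j r \<Longrightarrow> f' \<in> deg_funs j r \<Longrightarrow> (\<lambda>x. f x \<otimes> f' x) \<in> deg_funs j r"
proof (induction j arbitrary: r f f')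
  case (Suc j)
  show ?case
  proof (cases r)
    case (Suc r')
    from Suc.prems obtain g h g' h' where gh:
      "f = (\<lambda>x. g x \<otimes> (if x (Suc j) then h x else \<one>))"
      "f' = (\<lambda>x. g' x \<otimes> (if x (Suc j) then h' x else \<one>))"
      "g \<in> deg_funs j (Suc r')" "h \<in> deg_funs j r'" "g' \<in> deg_funs j (Suc r')" "h' \<in> deg_funs j r'"
      unfolding Suc by auto
    have cl: "g x \<in> carrier G" "h x \<in> carrier G" "g' x \<in> carrier G" "h' x \<in> carrier G" for x
      using gh by (auto intro: deg_funs_closed)
    have "(\<lambda>x. f x \<otimes> f' x) = (\<lambda>x. (g x \<otimes> g' x) \<otimes> (if x (Suc j) then h x \<otimes> h' x else \<one>))"
      using cl by (auto simp: gh m_ac)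
    then show ?thesis
      using deg_funs_step [OF Suc.IH [OF gh(3,5)] Suc.IH [OF gh(4,6)]] by (simp only: Suc)
  qed (use Suc.prems in auto)
qed auto

lemma deg_funs_inv: "f \<in> deg_funs j r \<Longrightarrow> (\<lambda>x. inv (f x)) \<in> deg_funs j r"
proof (induction rule: deg_funs_induct)
  case (const j r c)
  then show ?case by (intro deg_funs_const) auto
next
  case (step j r g h)
  have "(\<lambda>x. inv (g x \<otimes> (if x (Suc j) then h x else \<one>))) =
        (\<lambda>x. inv (g x) \<otimes> (if x (Suc j) then inv (h x) else \<one>))"
    using step.hyps by (auto simp: inv_mult deg_funs_closed)
  then show ?case
    using deg_funs_step [OF step.IH] by (simp only:)
qed

text \<open>Roots are chosen coefficient by coefficient. Since values commute, a product of roots is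
  a root of the product, and the degree does not grow.\<close>

lemma deg_funs_sqrt:
  assumes sq: "\<And>u. u \<in> carrier G \<Longrightarrow> \<exists>v\<in>carrier G. v \<otimes> v = u"
  shows "f \<in> deg_funs j r \<Longrightarrow> \<exists>s\<in>deg_funs j r. \<forall>x. s x \<otimes> s x = f x"
proof (induction rule: deg_funs_induct)
  case (const j r c)
  then show ?case using sq [of c] deg_funs_const by fast
next
  case (step j r g h)
  then obtain g' h' where gh: "g' \<in> deg_funs j (Suc r)" "h' \<in> deg_funs j r"
    "\<And>x. g' x \<otimes> g' x = g x" "\<And>x. h' x \<otimes> h' x = h x" by blast
  have cl: "g' x \<in> carrier G" "h' x \<in> carrier G" for x
    using gh by (auto intro: deg_funs_closed)
  let ?s = "\<lambda>x. g' x \<otimes> (if x (Suc j) then h' x else \<one>)"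
  have "?s x \<otimes> ?s x = (g' x \<otimes> g' x) \<otimes> (if x (Suc j) then h' x \<otimes> h' x else \<one>)" for x
    using cl [of x] by (simp add: m_ac)
  then show ?case
    using deg_funs_step [OF gh(1,2)] unfolding gh(3,4) by (intro bexI [of _ ?s]) auto
qed

lemma deg_funs_Suc_mono: "f \<in> deg_funs j r \<Longrightarrow> f \<in> deg_funs (Suc j) r"
proof (cases r)
  case (Suc r')
  assume f: "f \<in> deg_funs j r"
  have "(\<lambda>x. f x \<otimes> (if x (Suc j) then \<one> else \<one>)) \<in> deg_funs (Suc j) (Suc r')"
    using f Suc by (intro deg_funs_step deg_funs_const) auto
  then show ?thesis
    using f Suc by (simp add: deg_funs_closed del: deg_funs.simps)
next
  case 0
  assume "f \<in> deg_funs j r"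
  then show ?thesis using 0 by (cases j) auto
qed

lemma deg_funs_Suc_degree: "f \<in> deg_funs j r \<Longrightarrow> f \<in> deg_funs j (Suc r)"
proof (induction rule: deg_funs_induct)
  case (const j r c)
  then show ?case by (intro deg_funs_const)
next
  case (step j r g h)
  show ?case using step.IH by (rule deg_funs_step)
qed

text \<open>These are the block functions of the gates in a k-rUCG. If the top bit lies in
  \<open>Q\<close>, its coefficient is the monomial of the remaining bits, which uses up one
  degree.\<close>

lemma deg_funs_monomial:
  "Q \<subseteq> {1..j} \<Longrightarrow> card Q \<le> r \<Longrightarrow> u \<in> carrier G \<Longrightarrow>
   (\<lambda>x. if \<forall>q\<in>Q. x q then u else \<one>) \<in> deg_funs j r"
proof (induction j arbitrary: Q r)
  case 0
  then show ?case by auto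
next
  case (Suc j)
  show ?case
  proof (cases "Suc j \<in> Q")
    case False
    with Suc.prems have "Q \<subseteq> {1..j}" by (force simp: le_Suc_eq)
    with Suc show ?thesis by (intro deg_funs_Suc_mono) auto
  next
    case True
    define P where "P = Q - {Suc j}"
    have fin: "finite Q" using Suc.prems finite_subset by blast
    from True fin Suc.prems(2) have "r \<noteq> 0" by (metis card_0_eq empty_iff le_zero_eq)
    then obtain r' where r: "r = Suc r'" using not0_implies_Suc by blast
    have "P \<subseteq> {1..j}" "card P \<le> r'"
      using Suc.prems True fin by (auto simp: P_def r le_Suc_eq)
    note step = deg_funs_step [OF deg_funs_const Suc.IH [OF this Suc.prems(3)], of \<one>]
    have "Q = insert (Suc j) P" using True by (auto simp: P_def)
    then have "(\<lambda>x. if \<forall>q\<in>Q. x q then u else \<one>) =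
      (\<lambda>x. \<one> \<otimes> (if x (Suc j) then if \<forall>q\<in>P. x q then u else \<one> else \<one>))"
      using Suc.prems(3) by (auto simp: fun_eq_iff)
    then show ?thesis using step by (simp only: r one_closed)
  qed
qed

text \<open>With \<open>h = s \<otimes> s\<close>, the factor \<open>h\<close> conditioned on the
  top bit is \<open>s\<close> times a factor that is \<open>s\<close> if the bit is set and
  \<open>inv s\<close> otherwise. Hence \<open>p = g \<otimes> s\<close> and
  \<open>t = inv s\<close>. Here \<open>p\<close> has one bit less, and \<open>t\<close> one bit and
  one degree less, as in Pascal's rule.\<close>

lemma deg_funs_sign_split:
  assumes sq: "\<And>u. u \<in> carrier G \<Longrightarrow> \<exists>v\<in>carrier G. v \<otimes> v = u"
    and f: "f \<in> deg_funs (Suc j) (Suc r)"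
  obtains p t where "p \<in> deg_funs j (Suc r)" "t \<in> deg_funs j r"
    "\<And>x. f x = p x \<otimes> (if x (Suc j) then inv (t x) else t x)"
proof -
  from f obtain g h where gh: "g \<in> deg_funs j (Suc r)" "h \<in> deg_funs j r"
    "f = (\<lambda>x. g x \<otimes> (if x (Suc j) then h x else \<one>))" by auto
  obtain s where s: "s \<in> deg_funs j r" "\<And>x. s x \<otimes> s x = h x"
    using deg_funs_sqrt [OF sq gh(2)] by blast
  have cl: "g x \<in> carrier G" "s x \<in> carrier G" for x
    using gh s by (auto intro: deg_funs_closed)
  show thesis
  proof
    show "(\<lambda>x. g x \<otimes> s x) \<in> deg_funs j (Suc r)"
      using deg_funs_mult [OF gh(1) deg_funs_Suc_degree [OF s(1)]] .
    show "(\<lambda>x. inv (s x)) \<in> deg_funs j r"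
      using s by (intro deg_funs_inv)
    show "f x = g x \<otimes> s x \<otimes> (if x (Suc j) then inv (inv (s x)) else inv (s x))" for x
      using cl [of x] by (simp add: gh(3) s(2) [symmetric] m_assoc)
  qed
qed

end

section \<open>Binomial sums and products of gate matrices\<close>

text \<open>Pascal's rule, summed: it adds up the CU counts of the two parts when a function is
  split along its top bit.\<close>

lemma sum_choose_Suc:
  "(\<Sum>i=0..Suc r. Suc j choose i) = (\<Sum>i=0..Suc r. j choose i) + (\<Sum>i=0..r. j choose i)"
  unfolding sum.atLeast0_atMost_Suc_shift [of _ r] by (simp add: sum.distrib)

lemma mat_prod_carrier:
  "set As \<subseteq> carrier_mat d d \<Longrightarrow> mat_prod d As \<in> carrier_mat d d"
  unfolding mat_prod_def by (induction As) auto

lemma mat_prod_append: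
  assumes "set As \<subseteq> carrier_mat d d" "set Bs \<subseteq> carrier_mat d d"
  shows "mat_prod d (As @ Bs) = mat_prod d As * mat_prod d Bs"
  using assms(1)
proof (induction As)
  case Nil
  then show ?case using mat_prod_carrier [OF assms(2)] by (simp add: mat_prod_def)
next
  case (Cons A As)
  then have "A * (mat_prod d As * mat_prod d Bs) = A * mat_prod d As * mat_prod d Bs"
    using mat_prod_carrier assms(2) by (intro assoc_mult_mat [symmetric]) auto
  with Cons show ?case by (simp add: mat_prod_def)
qed

lemma gate_mat_carrier [simp]: "gate_mat n m g \<in> carrier_mat (2 ^ (n + m)) (2 ^ (n + m))"
  by (cases g) (auto simp: ctrl_gate_def)

lemma gate_mats_carrier [simp]: "gate_mat n m ` A \<subseteq> carrier_mat (2 ^ (n + m)) (2 ^ (n + m))"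
  by auto

section \<open>Circuits for functions of bounded degree\<close>

text \<open>The target family as an abstract abelian group of matrices, so that blocks obey group
  laws; \<open>sqrt\<close> is 2-divisibility.\<close>

locale target_group = comm_group G for G :: "complex mat monoid" (structure) +
  fixes n m :: nat
  assumes mult_eq: "x \<otimes> y = x * y"
    and one_eq: "\<one> = 1\<^sub>m (2 ^ m)"
    and carrier_dim: "carrier G \<subseteq> carrier_mat (2 ^ m) (2 ^ m)"
    and sqrt: "u \<in> carrier G \<Longrightarrow> \<exists>v\<in>carrier G. v \<otimes> v = u"
begin

definition realizes :: "gate list \<Rightarrow> ((nat \<Rightarrow> bool) \<Rightarrow> complex mat) \<Rightarrow> bool" where
  "realizes gs F \<longleftrightarrow> (\<forall>g\<in>set gs. valid_gate n m (carrier G) g) \<and>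
     mat_prod (2 ^ (n + m)) (map (gate_mat n m) gs) = block_diag n m F"

abbreviation "num_CU gs \<equiv> length (filter is_CU_gate gs)"
abbreviation "num_U gs \<equiv> length (filter is_U_gate gs)"
abbreviation "num_CNOT gs \<equiv> length (filter is_CNOT_gate gs)"

lemma block_diag_group_mult:
  assumes "\<And>x. F x \<in> carrier G" "\<And>x. H x \<in> carrier G"
  shows "block_diag n m F * block_diag n m H = block_diag n m (\<lambda>x. F x \<otimes> H x)"
  using assms carrier_dim by (subst block_diag_mult) (auto simp: mult_eq)

lemma realizes_append:
  assumes "realizes gs F" "realizes hs H" "\<And>x. F x \<in> carrier G" "\<And>x. H x \<in> carrier G"
  shows "realizes (gs @ hs) (\<lambda>x. F x \<otimes> H x)"
  using assms block_diag_group_mult [of F H]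
  by (auto simp: realizes_def mat_prod_append)

lemma realizes_CU:
  assumes "q \<in> {1..n}" "V \<in> carrier G"
  shows "realizes [CU_gate q V] (\<lambda>x. if x q then V else \<one>)"
  unfolding one_eq using assms by (auto simp: realizes_def mat_prod_def ctrl_gate_eq_block_diag)

lemma realizes_U:
  assumes "V \<in> carrier G"
  shows "realizes [U_gate V] (\<lambda>x. V)"
  using assms by (auto simp: realizes_def mat_prod_def ctrl_gate_eq_block_diag)

lemma realizes_cnot_conj:
  assumes "realizes gs F" "c \<in> {1..n}" "t \<in> {1..n}" "c \<noteq> t"
    and "\<And>x y. (\<forall>q\<in>{1..n}. x q = y q) \<Longrightarrow> F x = F y"
  shows "realizes (CNOT_gate c t # gs @ [CNOT_gate c t]) (\<lambda>x. F (cnot_bits c t x))"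
proof -
  have "mat_prod (2 ^ (n + m)) (map (gate_mat n m) (CNOT_gate c t # gs @ [CNOT_gate c t])) =
        cnot_gate (n + m) c t * (mat_prod (2 ^ (n + m)) (map (gate_mat n m) gs) * cnot_gate (n + m) c t)"
    using mat_prod_append [of "map (gate_mat n m) gs" "2 ^ (n + m)" "[cnot_gate (n + m) c t]"]
    by (simp add: mat_prod_def right_mult_one_mat [OF cnot_gate_carrier])
  then show ?thesis
    using assms cnot_gate_conj_block_diag [of t c n F m] by (auto simp: realizes_def)
qed

text \<open>A signed constant is \<open>c\<close> times \<open>inv c \<otimes> inv c\<close>
  conditioned on \<open>q\<close>. So one CU gate suffices, with \<open>u = inv c\<close> left over,
  and the binomial sum is 1 in both cases.\<close>

lemma realizes_sign_const:
  assumes "c \<in> carrier G" "1 \<le> q" "q \<le> n" "j = 0 \<or> r = 0"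
  shows "\<exists>gs. \<exists>u\<in>carrier G. realizes gs (\<lambda>x. u \<otimes> (if x q then inv c else c)) \<and>
           num_U gs = 0 \<and> num_CU gs = (\<Sum>i=0..r. j choose i) \<and> num_CNOT gs + 2 \<le> 2 * num_CU gs"
proof (intro exI bexI conjI)
  have "realizes [CU_gate q (inv c \<otimes> inv c)] (\<lambda>x. if x q then inv c \<otimes> inv c else \<one>)"
    using assms by (intro realizes_CU) auto
  also have "(\<lambda>x. if x q then inv c \<otimes> inv c else \<one>) = (\<lambda>x. inv c \<otimes> (if x q then inv c else c))"
    using assms by auto
  finally show "realizes [CU_gate q (inv c \<otimes> inv c)] (\<lambda>x. inv c \<otimes> (if x q then inv c else c))" .
  have "(\<Sum>i=0..r. 0 choose i) = (1 :: nat)"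
    by (induction r) auto
  with assms(4) show "num_CU [CU_gate q (inv c \<otimes> inv c)] = (\<Sum>i=0..r. j choose i)" by auto
qed (use assms in auto)

text \<open>Bit \<open>q\<close> carries the sign, and \<open>j < q\<close> ensures that CNOTs
  targeting \<open>q\<close> do not disturb \<open>s\<close>, which depends on the bits up to
  \<open>j\<close> only. The CNOT bound amounts to two for every CU gate beyond the first.\<close>

lemma realizes_sign:
  assumes "s \<in> deg_funs j r" "j < q" "q \<le> n"
  shows "\<exists>gs. \<exists>u\<in>carrier G. realizes gs (\<lambda>x. u \<otimes> (if x q then inv (s x) else s x)) \<and>
           num_U gs = 0 \<and> num_CU gs = (\<Sum>i=0..r. j choose i) \<and> num_CNOT gs + 2 \<le> 2 * num_CU gs"
  using assms
proof (induction j arbitrary: r s)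
  case 0
  then show ?case using realizes_sign_const [of _ q 0 r] by auto
next
  case (Suc j)
  show ?case
  proof (cases r)
    case 0
    with Suc.prems show ?thesis using realizes_sign_const [of _ q "Suc j" r] by auto
  next
    case r: (Suc r')
    \<comment> \<open>The sign of \<open>x q\<close> distributes over this split: \<open>p\<close>
      gets that sign, while for \<open>t\<close> the signs of \<open>x q\<close> and
      \<open>x (Suc j)\<close> multiply to the sign of their parity.\<close>
    obtain p t where pt: "p \<in> deg_funs j (Suc r')" "t \<in> deg_funs j r'"
      "\<And>x. s x = p x \<otimes> (if x (Suc j) then inv (t x) else t x)"
      using deg_funs_sign_split [OF sqrt] Suc.prems(1) unfolding r by blast
    have cl: "p x \<in> carrier G" "t x \<in> carrier G" for x
      using pt by (auto intro: deg_funs_closed)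
    have q: "Suc j \<in> {1..n}" "q \<in> {1..n}" "Suc j \<noteq> q" "j < q"
      using Suc.prems by auto
    obtain gs u where gs: "u \<in> carrier G" "realizes gs (\<lambda>x. u \<otimes> (if x q then inv (p x) else p x))"
      "num_U gs = 0" "num_CU gs = (\<Sum>i=0..Suc r'. j choose i)" "num_CNOT gs + 2 \<le> 2 * num_CU gs"
      using Suc.IH [OF pt(1)] q Suc.prems by auto
    obtain hs v where hs: "v \<in> carrier G" "realizes hs (\<lambda>x. v \<otimes> (if x q then inv (t x) else t x))"
      "num_U hs = 0" "num_CU hs = (\<Sum>i=0..r'. j choose i)" "num_CNOT hs + 2 \<le> 2 * num_CU hs"
      using Suc.IH [OF pt(2)] q Suc.prems by auto
    \<comment> \<open>\<open>hs\<close> carries the sign of \<open>x q\<close>; conjugation by a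
      CNOT from \<open>Suc j\<close> to \<open>q\<close> turns it into the sign of the
      parity.\<close>
    let ?hs = "CNOT_gate (Suc j) q # hs @ [CNOT_gate (Suc j) q]"
    have t_cong: "t x = t y" if "\<forall>i\<in>{1..n}. i \<noteq> q \<longrightarrow> x i = y i" for x y
      using that q by (intro deg_funs_cong [OF pt(2)]) auto
    have "realizes ?hs (\<lambda>x. v \<otimes> (if cnot_bits (Suc j) q x q
        then inv (t (cnot_bits (Suc j) q x)) else t (cnot_bits (Suc j) q x)))"
    proof (rule realizes_cnot_conj [OF hs(2) q(1-3)])
      fix x y :: "nat \<Rightarrow> bool"
      assume "\<forall>i\<in>{1..n}. x i = y i"
      with t_cong [of x y] q(2) show "v \<otimes> (if x q then inv (t x) else t x) = v \<otimes> (if y q then inv (t y) else t y)"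
        by simp
    qed
    also have "(\<lambda>x. v \<otimes> (if cnot_bits (Suc j) q x q
        then inv (t (cnot_bits (Suc j) q x)) else t (cnot_bits (Suc j) q x))) =
      (\<lambda>x. v \<otimes> (if x q \<noteq> x (Suc j) then inv (t x) else t x))"
    proof
      fix x
      have "t (cnot_bits (Suc j) q x) = t x"
        by (rule t_cong) (simp add: cnot_bits_def)
      moreover have "cnot_bits (Suc j) q x q \<longleftrightarrow> x q \<noteq> x (Suc j)"
        by (simp add: cnot_bits_def)
      ultimately show "v \<otimes> (if cnot_bits (Suc j) q x q
          then inv (t (cnot_bits (Suc j) q x)) else t (cnot_bits (Suc j) q x)) =
        v \<otimes> (if x q \<noteq> x (Suc j) then inv (t x) else t x)"
        by (simp only:)
    qed
    finally have "realizes (gs @ ?hs) (\<lambda>x. u \<otimes> (if x q then inv (p x) else p x) \<otimes>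
        (v \<otimes> (if x q \<noteq> x (Suc j) then inv (t x) else t x)))"
      using gs hs cl by (intro realizes_append) auto
    also have "(\<lambda>x. u \<otimes> (if x q then inv (p x) else p x) \<otimes>
        (v \<otimes> (if x q \<noteq> x (Suc j) then inv (t x) else t x))) =
      (\<lambda>x. u \<otimes> v \<otimes> (if x q then inv (s x) else s x))"
    proof
      fix x
      show "u \<otimes> (if x q then inv (p x) else p x) \<otimes> (v \<otimes> (if x q \<noteq> x (Suc j) then inv (t x) else t x)) =
        u \<otimes> v \<otimes> (if x q then inv (s x) else s x)"
        using gs(1) hs(1) cl [of x] by (auto simp: pt(3) inv_mult m_ac)
    qed
    \<comment> \<open>Each part comes with slack 2 in its CNOT bound. The new pair of CNOTs consumes
      one slack; the other remains for the result.\<close>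
    finally show ?thesis
      using gs hs sum_choose_Suc [of j r']
      by (intro exI [of _ "gs @ ?hs"] bexI [of _ "u \<otimes> v"]) (auto simp: r)
  qed
qed

text \<open>The empty circuit suffices, as \<open>u = inv c\<close> cancels the constant. The sum
  from 1 vanishes in both cases.\<close>

lemma realizes_const:
  assumes "c \<in> carrier G" "j = 0 \<or> k = 0"
  shows "\<exists>gs. \<exists>u\<in>carrier G. realizes gs (\<lambda>x. u \<otimes> c) \<and>
           num_U gs = 0 \<and> num_CU gs = (\<Sum>i=1..k. j choose i) \<and> num_CNOT gs \<le> 2 * num_CU gs"
proof (intro exI bexI conjI)
  show "realizes [] (\<lambda>x. inv c \<otimes> c)"
    using assms by (simp add: realizes_def mat_prod_def one_eq block_diag_one)
  show "num_CU [] = (\<Sum>i=1..k. j choose i)" using assms(2) by auto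
qed (use assms in auto)

text \<open>The unsigned part of each split is treated recursively; the signed part goes to
  \<open>realizes_sign\<close> with the top control itself as sign bit, so this level adds no CNOTs.
  The constants accumulate in \<open>u\<close>.\<close>

lemma realizes_deg_fun:
  assumes "f \<in> deg_funs j k" "j \<le> n"
  shows "\<exists>gs. \<exists>u\<in>carrier G. realizes gs (\<lambda>x. u \<otimes> f x) \<and>
           num_U gs = 0 \<and> num_CU gs = (\<Sum>i=1..k. j choose i) \<and> num_CNOT gs \<le> 2 * num_CU gs"
  using assms
proof (induction j arbitrary: k f)
  case 0
  then show ?case using realizes_const [of _ 0 k] by auto
next
  case (Suc j)
  show ?case
  proof (cases k)
    case 0
    with Suc.prems show ?thesis using realizes_const [of _ "Suc j" k] by auto
  next
    case k: (Suc k')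
    obtain p t where pt: "p \<in> deg_funs j (Suc k')" "t \<in> deg_funs j k'"
      "\<And>x. f x = p x \<otimes> (if x (Suc j) then inv (t x) else t x)"
      using deg_funs_sign_split [OF sqrt] Suc.prems(1) unfolding k by blast
    have cl: "p x \<in> carrier G" "t x \<in> carrier G" for x
      using pt by (auto intro: deg_funs_closed)
    obtain gs u where gs: "u \<in> carrier G" "realizes gs (\<lambda>x. u \<otimes> p x)"
      "num_U gs = 0" "num_CU gs = (\<Sum>i=1..Suc k'. j choose i)" "num_CNOT gs \<le> 2 * num_CU gs"
      using Suc.IH [OF pt(1)] Suc.prems by auto
    obtain hs v where hs: "v \<in> carrier G"
      "realizes hs (\<lambda>x. v \<otimes> (if x (Suc j) then inv (t x) else t x))"
      "num_U hs = 0" "num_CU hs = (\<Sum>i=0..k'. j choose i)" "num_CNOT hs + 2 \<le> 2 * num_CU hs"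
      using realizes_sign [OF pt(2) lessI] Suc.prems by auto
    have "realizes (gs @ hs) (\<lambda>x. u \<otimes> p x \<otimes> (v \<otimes> (if x (Suc j) then inv (t x) else t x)))"
      using gs hs cl by (intro realizes_append) auto
    also have "(\<lambda>x. u \<otimes> p x \<otimes> (v \<otimes> (if x (Suc j) then inv (t x) else t x))) = (\<lambda>x. u \<otimes> v \<otimes> f x)"
    proof
      fix x
      show "u \<otimes> p x \<otimes> (v \<otimes> (if x (Suc j) then inv (t x) else t x)) = u \<otimes> v \<otimes> f x"
        using gs(1) hs(1) cl [of x] by (auto simp: pt(3) m_ac)
    qed
    finally have "realizes (gs @ hs) (\<lambda>x. u \<otimes> v \<otimes> f x)" .
    \<comment> \<open>The terms for \<open>i = 0\<close> on the left and in the first sum on the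
      right are both 1 and cancel in \<open>sum_choose_Suc\<close>.\<close>
    moreover have "(\<Sum>i=1..Suc k'. Suc j choose i) = (\<Sum>i=1..Suc k'. j choose i) + (\<Sum>i=0..k'. j choose i)"
      using sum_choose_Suc [of j k'] by (simp add: sum.atLeast_Suc_atMost)
    ultimately show ?thesis
      using gs hs by (intro exI [of _ "gs @ hs"] bexI [of _ "u \<otimes> v"]) (auto simp: k)
  qed
qed

lemma mat_prod_ctrl_gates:
  assumes "\<forall>(Q, U)\<in>set ps. Q \<subseteq> {1..n} \<and> card Q \<le> k \<and> U \<in> carrier G"
  shows "\<exists>f\<in>deg_funs n k. mat_prod (2 ^ (n + m)) (map (\<lambda>(Q, U). ctrl_gate n m Q U) ps) = block_diag n m f"
  using assms
proof (induction ps)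
  case Nil
  then show ?case
    by (intro bexI [of _ "\<lambda>x. \<one>"] deg_funs_const one_closed)
      (simp add: mat_prod_def one_eq block_diag_one)
next
  case (Cons p ps)
  obtain Q U where p: "p = (Q, U)" by force
  from Cons p have Q: "Q \<subseteq> {1..n}" "card Q \<le> k" "U \<in> carrier G" by auto
  from Cons obtain f where f: "f \<in> deg_funs n k"
    "mat_prod (2 ^ (n + m)) (map (\<lambda>(Q, U). ctrl_gate n m Q U) ps) = block_diag n m f" by auto
  note g = deg_funs_monomial [OF Q]
  have "ctrl_gate n m Q U * block_diag n m f =
        block_diag n m (\<lambda>x. (if \<forall>q\<in>Q. x q then U else \<one>) \<otimes> f x)"
    using Q f g by (simp only: ctrl_gate_eq_block_diag one_eq [symmetric])
      (intro block_diag_group_mult deg_funs_closed; assumption?; auto)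
  with f deg_funs_mult [OF g f(1)] show ?case
    by (auto simp: p mat_prod_def)
qed

end

section \<open>Decomposition of a k-rUCG into unit gates\<close>

theorem theorem3:
  fixes n m k :: nat and \<U> :: "complex mat set" and L :: "complex mat"
  assumes "n \<ge> 1" and "k \<le> n"
    and "subgroup \<U> (unitary_group (2 ^ m))"
    and "comm_group (unitary_group (2 ^ m)\<lparr>carrier := \<U>\<rparr>)"
    and "two_divisible \<U>"
    and "is_rUCG n m \<U> k L"
  shows "\<exists>gs. (\<forall>g\<in>set gs. valid_gate n m \<U> g) \<and>
              mat_prod (2 ^ (n + m)) (map (gate_mat n m) gs) = L \<and>
              length (filter is_CU_gate gs) = (\<Sum>i=1..k. n choose i) \<and>
              length (filter is_U_gate gs) = 1 \<and>
              length (filter is_CNOT_gate gs) < 2 * (\<Sum>i=0..k. n choose i)"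
proof -
  define G where "G = unitary_group (2 ^ m)\<lparr>carrier := \<U>\<rparr>"
  have carrier: "carrier G = \<U>" by (simp add: G_def)
  have "\<U> \<subseteq> carrier_mat (2 ^ m) (2 ^ m)"
    using subgroup.subset [OF assms(3)] by (auto simp: unitary_group_def unitary_mat_def)
  then interpret target_group G n m
    using assms(4,5)
    by (intro target_group.intro target_group_axioms.intro)
      (auto simp: G_def unitary_group_def two_divisible_def)
  obtain f where f: "f \<in> deg_funs n k" "L = block_diag n m f"
    using assms(6) mat_prod_ctrl_gates unfolding is_rUCG_def carrier by blast
  obtain gs u where gs: "u \<in> carrier G" "realizes gs (\<lambda>x. u \<otimes>\<^bsub>G\<^esub> f x)" "num_U gs = 0"
    "num_CU gs = (\<Sum>i=1..k. n choose i)" "num_CNOT gs \<le> 2 * num_CU gs"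
    using realizes_deg_fun [OF f(1) order_refl] by blast
  have cl: "f x \<in> carrier G" for x using f by (auto intro: deg_funs_closed)
  \<comment> \<open>One U gate undoes the accumulated constant. It is appended even if
    \<open>u\<close> is the identity, so exactly one occurs.\<close>
  have "realizes (gs @ [U_gate (inv\<^bsub>G\<^esub> u)]) (\<lambda>x. u \<otimes>\<^bsub>G\<^esub> f x \<otimes>\<^bsub>G\<^esub> inv\<^bsub>G\<^esub> u)"
    using gs cl by (intro realizes_append realizes_U) auto
  also have "(\<lambda>x. u \<otimes>\<^bsub>G\<^esub> f x \<otimes>\<^bsub>G\<^esub> inv\<^bsub>G\<^esub> u) = f"
  proof
    show "u \<otimes>\<^bsub>G\<^esub> f x \<otimes>\<^bsub>G\<^esub> inv\<^bsub>G\<^esub> u = f x" for x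
      using gs(1) cl [of x] by (simp add: m_comm [of u] m_assoc)
  qed
  finally have "realizes (gs @ [U_gate (inv\<^bsub>G\<^esub> u)]) f" .
  \<comment> \<open>The term \<open>n choose 0\<close>, absent from the CU count, makes the bound
    strict.\<close>
  moreover have "num_CNOT gs < 2 * (\<Sum>i=0..k. n choose i)"
    using gs(4,5) by (simp add: sum.atLeast_Suc_atMost)
  ultimately show ?thesis
    using gs f by (intro exI [of _ "gs @ [U_gate (inv\<^bsub>G\<^esub> u)]"]) (simp add: realizes_def carrier)
qed

end
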